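(* Let $\Omega\subseteq\mathbb{R}^n$ and $f:\Omega\to\mathbb{R}^n$, and let $G\subseteq\Omega$ be forward invariant. Consider the following conditions. (i) There exist $C_1,C_2>0$, $C_3\geq0$, $q>r>0$, and a continuous function $V_{(i)}:G\to\mathbb{R}_+$ such that for all $x\in G$: $C_1\|x\|_2^r\leq V_{(i)}(x)\leq C_2\|x\|_2^r$ and $\dot V_{(i)}(x)\leq-C_3\|x\|_2^q$. (ii) There exist $c\geq0$, $\gamma,p,r>0$, and a continuous function $V_{(ii)}:G\to\mathbb{R}_+$ such that for all $x\in G$: $\gamma^{-1}\|x\|_2^r\leq V_{(ii)}(x)\leq\|x\|_2^r$ and $\dot V_{(ii)}(x)\leq-cV_{(ii)}(x)\|x\|_2^p$. (iii) There exist $c_1,c_2>0$, $c_3\geq0$, $r,s>0$, and a continuous function $V_{(iii)}:G\to\mathbb{R}_+$ such that for all $x\in G$: $c_1\|x\|_2^r\leq V_{(iii)}(x)\leq c_2\|x\|_2^r$ and $\dot V_{(iii)}(x)\leq-c_3V_{(iii)}(x)^{1+s}$. (iv) $f$ is rationally stable on $G$ with power $p>0$, rate $k>0$, and gain $M\geq1$. Then the following statements hold. 1) (i) implies (iv) with $p=q-r$, $M=\left(\frac{C_2}{C_1}\right)^{\frac{q}{r}-1}$, $k=\left(\frac{q}{r}-1\right)\frac{C_3}{C_2}$. 2) (iv) implies (i) with $C_1=\frac1M$, $C_2=1$, $C_3=\frac{\bar k}{M^2}$, $r=p$, $q=2p$, for any $\bar k\in[0,k)$. 3) (ii) implies (iv)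 (with the same $p$) with $M=\gamma^{p/r}$, $k=\frac{cp}{r}$. 4) (iv) implies (ii) (with the same $p$) with $r=p$, $\gamma=M$, $c=\frac{\bar k}{M}$, for any $\bar k\in[0,k)$. 5) (iii) implies (iv) with $p=rs$, $M=\left(\frac{c_2}{c_1}\right)^s$, $k=s\frac{c_3}{c_2^{s}}$. 6) (iv) implies (iii) with $c_1=\frac1M$, $c_2=1$, $c_3=\bar k$, $r=p$, and $s=1$, for any $\bar k\in[0,k)$.
   Context: $\mathbb{R}_+:=[0,\infty)$. For a vector field $f:\Omega\to\mathbb{R}^n$ on $\Omega\subseteq\mathbb{R}^n$, $\phi_f(x,t)$ denotes the solution at time $t$ of the corresponding ODE initialized at $x$: $\frac{\partial}{\partial t}\phi_f(x,t)=f(\phi_f(x,t))$, $\phi_f(x,0)=x$. Standing assumption: the solutions under consideration exist uniquely for all $t\in\mathbb{R}_+$ and depend continuously on their initial conditions. A set $G\subseteq\Omega$ is forward invariant if $x\in G$ implies $\phi_f(x,t)\in G$ for all $t\geq0$. For continuous $V$, $\dot V(x):=\limsup_{\Delta t\to0^+}\frac{V(\phi_f(x,\Delta t))-V(x)}{\Delta t}$ (upper right-hand Dini derivative along solutions). For given $G$, $p,k>0$, and $M\geq1$, $f$ is rationally stable on $G$ with power $p$, rate $k$, and gain $M$ if $\|\phi_f(x,t)\|_2^p\leq M\frac{\|x\|_2^p}{1+\|x\|_2^p kt}$ for all $x\in G$ and $t\geq0$.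
   Formalization: In 5) the printed k fails for c2<1 (f(x)=-x² on (0,∞), V=x/2): it is claimed for c2≥1, and k=s·c3·c2^s in general. In 1), 3), 5), k>0 and M≥1 are claimed only if C3 (c, c3)>0 and G has a nonzero point; the estimate always. Continuous dependence is joint in (x,t). *)

theory Defs
  imports "HOL-Analysis.Analysis"
begin

text \<open>
  A vector field on \<open>\<Omega>\<close> is a total function of which only the values on \<open>\<Omega>\<close> matter. Solutions are
  differentiable curves on \<open>[0,\<infinity>)\<close> that stay in \<open>\<Omega>\<close>; the derivative at time \<open>0\<close> is one-sided.
\<close>

definition solves_ivp ::
  "(real ^ 'n) set \<Rightarrow> (real ^ 'n \<Rightarrow> real ^ 'n) \<Rightarrow> real ^ 'n \<Rightarrow> (real \<Rightarrow> real ^ 'n) \<Rightarrow> bool" where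
  "solves_ivp \<Omega> f x y \<longleftrightarrow>
     y 0 = x \<and>
     (\<forall>t\<ge>0. y t \<in> \<Omega> \<and> (y has_vector_derivative f (y t)) (at t within {0..}))"

text \<open>The description is proper for \<open>t \<ge> 0\<close> once the solution from \<open>x\<close> exists and is unique.\<close>

definition flow ::
  "(real ^ 'n) set \<Rightarrow> (real ^ 'n \<Rightarrow> real ^ 'n) \<Rightarrow> real ^ 'n \<Rightarrow> real \<Rightarrow> real ^ 'n" where
  "flow \<Omega> f x t = (THE z. \<exists>y. solves_ivp \<Omega> f x y \<and> y t = z)"

text \<open>
  Continuous dependence on the initial condition is understood as usual for differential equations,
  locally uniformly in time, that is, as joint continuity of the flow.
\<close>

definition well_posed_on ::
  "(real ^ 'n) set \<Rightarrow> (real ^ 'n \<Rightarrow> real ^ 'n) \<Rightarrow> (real ^ 'n) set \<Rightarrow> bool" where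
  "well_posed_on \<Omega> f G \<longleftrightarrow>
     (\<forall>x\<in>G. \<exists>y. solves_ivp \<Omega> f x y) \<and>
     (\<forall>x\<in>G. \<forall>y z. solves_ivp \<Omega> f x y \<and> solves_ivp \<Omega> f x z \<longrightarrow> (\<forall>t\<ge>0. y t = z t)) \<and>
     continuous_on (G \<times> {0..}) (\<lambda>(x, t). flow \<Omega> f x t)"

definition forward_invariant ::
  "(real ^ 'n) set \<Rightarrow> (real ^ 'n \<Rightarrow> real ^ 'n) \<Rightarrow> (real ^ 'n) set \<Rightarrow> bool" where
  "forward_invariant \<Omega> f G \<longleftrightarrow> (\<forall>x\<in>G. \<forall>t\<ge>0. flow \<Omega> f x t \<in> G)"

text \<open>The Dini derivative is extended-real valued, since the limes superior may be infinite.\<close>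

definition dini_deriv ::
  "(real ^ 'n) set \<Rightarrow> (real ^ 'n \<Rightarrow> real ^ 'n) \<Rightarrow> (real ^ 'n \<Rightarrow> real) \<Rightarrow> real ^ 'n \<Rightarrow> ereal" where
  "dini_deriv \<Omega> f V x =
     Limsup (at_right 0) (\<lambda>h. ereal ((V (flow \<Omega> f x h) - V x) / h))"

text \<open>
  The bare estimate is kept apart from the parameter ranges of rational stability because it also
  makes sense for rate \<open>0\<close>.
\<close>

definition rational_estimate ::
  "(real ^ 'n) set \<Rightarrow> (real ^ 'n \<Rightarrow> real ^ 'n) \<Rightarrow> (real ^ 'n) set \<Rightarrow> real \<Rightarrow> real \<Rightarrow> real \<Rightarrow> bool" where
  "rational_estimate \<Omega> f G p k M \<longleftrightarrow>
     (\<forall>x\<in>G. \<forall>t\<ge>0. norm (flow \<Omega> f x t) powr p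
        \<le> M * (norm x powr p / (1 + norm x powr p * k * t)))"

definition rationally_stable ::
  "(real ^ 'n) set \<Rightarrow> (real ^ 'n \<Rightarrow> real ^ 'n) \<Rightarrow> (real ^ 'n) set \<Rightarrow> real \<Rightarrow> real \<Rightarrow> real \<Rightarrow> bool" where
  "rationally_stable \<Omega> f G p k M \<longleftrightarrow>
     p > 0 \<and> k > 0 \<and> M \<ge> 1 \<and> rational_estimate \<Omega> f G p k M"

definition lyapunov_i ::
  "(real ^ 'n) set \<Rightarrow> (real ^ 'n \<Rightarrow> real ^ 'n) \<Rightarrow> (real ^ 'n) set
     \<Rightarrow> real \<Rightarrow> real \<Rightarrow> real \<Rightarrow> real \<Rightarrow> real \<Rightarrow> bool" where
  "lyapunov_i \<Omega> f G C1 C2 C3 q r \<longleftrightarrow>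
     C1 > 0 \<and> C2 > 0 \<and> C3 \<ge> 0 \<and> q > r \<and> r > 0 \<and>
     (\<exists>V :: real ^ 'n \<Rightarrow> real. continuous_on G V \<and>
        (\<forall>x\<in>G. V x \<ge> 0 \<and>
           C1 * norm x powr r \<le> V x \<and> V x \<le> C2 * norm x powr r \<and>
           dini_deriv \<Omega> f V x \<le> ereal (- C3 * norm x powr q)))"

definition lyapunov_ii ::
  "(real ^ 'n) set \<Rightarrow> (real ^ 'n \<Rightarrow> real ^ 'n) \<Rightarrow> (real ^ 'n) set
     \<Rightarrow> real \<Rightarrow> real \<Rightarrow> real \<Rightarrow> real \<Rightarrow> bool" where
  "lyapunov_ii \<Omega> f G c \<gamma> p r \<longleftrightarrow>
     c \<ge> 0 \<and> \<gamma> > 0 \<and> p > 0 \<and> r > 0 \<and>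
     (\<exists>V :: real ^ 'n \<Rightarrow> real. continuous_on G V \<and>
        (\<forall>x\<in>G. V x \<ge> 0 \<and>
           inverse \<gamma> * norm x powr r \<le> V x \<and> V x \<le> norm x powr r \<and>
           dini_deriv \<Omega> f V x \<le> ereal (- c * V x * norm x powr p)))"

text \<open>
  The decay rate coming out of this condition is \<open>s * c3 * c2 powr s\<close>: replacing \<open>V\<close> by \<open>a * V\<close>
  replaces \<open>c2\<close> by \<open>a * c2\<close> and \<open>c3\<close> by \<open>c3 / a powr s\<close>, which leaves this rate unchanged. The value
  \<open>s * c3 / c2 powr s\<close> is a valid rate for \<open>c2 \<ge> 1\<close> but not in general.
\<close>

definition lyapunov_iii ::
  "(real ^ 'n) set \<Rightarrow> (real ^ 'n \<Rightarrow> real ^ 'n) \<Rightarrow> (real ^ 'n) set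
     \<Rightarrow> real \<Rightarrow> real \<Rightarrow> real \<Rightarrow> real \<Rightarrow> real \<Rightarrow> bool" where
  "lyapunov_iii \<Omega> f G c1 c2 c3 r s \<longleftrightarrow>
     c1 > 0 \<and> c2 > 0 \<and> c3 \<ge> 0 \<and> r > 0 \<and> s > 0 \<and>
     (\<exists>V :: real ^ 'n \<Rightarrow> real. continuous_on G V \<and>
        (\<forall>x\<in>G. V x \<ge> 0 \<and>
           c1 * norm x powr r \<le> V x \<and> V x \<le> c2 * norm x powr r \<and>
           dini_deriv \<Omega> f V x \<le> ereal (- c3 * V x powr (1 + s))))"

end

theory Submission
  imports Defs
begin

text \<open>
  Conditions (i) and (ii) both imply (iii), because the two-sided bounds allow powers of the norm to
  be traded for powers of \<open>V\<close>; and (iii) with exponent \<open>s\<close> says that \<open>V powr - s\<close> grows at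
  rate at least \<open>s * c3\<close> along solutions, which is the rational estimate. Conversely, rational
  stability makes the supremum over \<open>t \<ge> 0\<close> of \<open>u / (M - l * t * u)\<close>, where
  \<open>u = norm (flow \<Omega> f x t) powr p\<close>, a Lyapunov function for (iii), which the lower bound on it turns
  into (ii) and (i). It is continuous since \<open>l < k\<close> lets one restrict the supremum, locally
  uniformly away from the origin, to a compact time interval.
\<close>

section \<open>One-sided growth bounds and scalar decay\<close>

text \<open>The times in \<open>{a..b}\<close> at which \<open>u\<close> has not exceeded
  \<open>u a\<close> form a compact set containing \<open>a\<close>. Its largest element must be
  \<open>b\<close>, since before \<open>b\<close> the local hypothesis provides a later
  member.\<close>

lemma right_nonincreasing_imp_le:
  fixes u :: "real \<Rightarrow> real"
  assumes "a \<le> b" and cont: "continuous_on {a..b} u"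
    and dec: "\<And>t. a \<le> t \<Longrightarrow> t < b \<Longrightarrow> \<forall>\<^sub>F h in at_right 0. u (t + h) \<le> u t"
  shows "u b \<le> u a"
proof -
  define S where "S = {t \<in> {a..b}. u t \<le> u a}"
  have "closed S"
    unfolding S_def by (intro continuous_on_closed_Collect_le cont continuous_intros closed_atLeastAtMost)
  moreover have "bounded S"
    by (rule bounded_subset[of "{a..b}"]) (auto simp: S_def)
  ultimately have "compact S"
    using compact_eq_bounded_closed by blast
  moreover have "a \<in> S"
    using \<open>a \<le> b\<close> by (auto simp: S_def)
  ultimately obtain c where c: "c \<in> S" "\<And>t. t \<in> S \<Longrightarrow> t \<le> c"
    using compact_attains_sup[of S] by blast
  have "c = b"
  proof (rule ccontr)
    assume "c \<noteq> b"
    with c(1) have "a \<le> c" "c < b" "u c \<le> u a"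
      by (auto simp: S_def)
    have "\<forall>\<^sub>F h in at_right 0. h < b - c"
      using \<open>c < b\<close> by (intro order_tendstoD(2)[OF tendsto_ident_at]) auto
    moreover have "\<forall>\<^sub>F h in at_right (0::real). 0 < h"
      by (simp add: eventually_at_right_less)
    ultimately have "\<forall>\<^sub>F h in at_right 0. u (c + h) \<le> u c \<and> h < b - c \<and> 0 < h"
      using dec[OF \<open>a \<le> c\<close> \<open>c < b\<close>] by eventually_elim auto
    then obtain h where h: "u (c + h) \<le> u c" "h < b - c" "0 < h"
      using eventually_happens trivial_limit_at_right_real by blast
    then have "c + h \<in> S"
      using \<open>a \<le> c\<close> \<open>u c \<le> u a\<close> by (auto simp: S_def)
    then show False
      using c(2) h(3) by fastforce
  qed
  then show ?thesis
    using c(1) by (simp add: S_def)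
qed

text \<open>Subtract the line of slope \<open>m + e\<close> to reach the nonincreasing case, then
  let \<open>e\<close> tend to 0. The slack \<open>e\<close> in the hypothesis is there because a
  Limsup bounded by \<open>m\<close> bounds the quotients only by \<open>m + e\<close>.\<close>

lemma right_growth_le:
  fixes u :: "real \<Rightarrow> real"
  assumes "a \<le> b" and cont: "continuous_on {a..b} u"
    and growth: "\<And>t e. a \<le> t \<Longrightarrow> t < b \<Longrightarrow> e > 0 \<Longrightarrow>
      \<forall>\<^sub>F h in at_right 0. u (t + h) - u t \<le> (m + e) * h"
  shows "u b - u a \<le> m * (b - a)"
proof (rule field_le_epsilon)
  fix d :: real
  assume "d > 0"
  \<comment> \<open>The added 1 keeps the denominator positive when \<open>a = b\<close>.\<close>
  define e where "e = d / (b - a + 1)"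
  have "e > 0" and "e * (b - a) \<le> d"
    using \<open>d > 0\<close> \<open>a \<le> b\<close> by (auto simp: e_def field_simps)
  have "u b - (m + e) * b \<le> u a - (m + e) * a"
  proof (rule right_nonincreasing_imp_le[OF \<open>a \<le> b\<close>])
    show "continuous_on {a..b} (\<lambda>t. u t - (m + e) * t)"
      by (intro continuous_intros cont)
    show "\<forall>\<^sub>F h in at_right 0. u (t + h) - (m + e) * (t + h) \<le> u t - (m + e) * t"
      if "a \<le> t" "t < b" for t
      using growth[OF that \<open>e > 0\<close>] by eventually_elim (simp add: algebra_simps)
  qed
  with \<open>e * (b - a) \<le> d\<close> show "u b - u a \<le> m * (b - a) + d"
    by (simp add: algebra_simps)
qed

text \<open>Turns an extended-real Dini bound into the real inequality that
  \<open>right_growth_le\<close> takes as input; \<open>e > 0\<close> makes the bound strict, so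
  that it holds eventually.\<close>

lemma Limsup_at_right_quotient_le_imp:
  fixes d :: "real \<Rightarrow> real"
  assumes "Limsup (at_right 0) (\<lambda>h. ereal (d h / h)) \<le> ereal m" and "e > 0"
  shows "\<forall>\<^sub>F h in at_right 0. d h \<le> (m + e) * h"
proof -
  have "Limsup (at_right 0) (\<lambda>h. ereal (d h / h)) < ereal (m + e)"
    using assms by (simp add: le_less_trans[OF assms(1)])
  then have "\<forall>\<^sub>F h in at_right 0. ereal (d h / h) < ereal (m + e)"
    by (rule Limsup_lessD)
  moreover have "\<forall>\<^sub>F h in at_right (0::real). 0 < h"
    by (simp add: eventually_at_right_less)
  ultimately show ?thesis
    by eventually_elim (simp add: field_simps)
qed

text \<open>By this convexity estimate, no chain rule for Dini derivatives is needed.\<close>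

lemma powr_minus_tangent_le:
  fixes x y s :: real
  assumes "x > 0" "y > 0" "s > 0"
  shows "- s * x powr (- s - 1) * (y - x) \<le> y powr - s - x powr - s"
proof (rule convex_on_imp_above_tangent[where A = "{0<..}"])
  show "convex_on {0<..} (\<lambda>y::real. y powr - s)"
  proof (rule f''_ge0_imp_convex)
    fix z :: real
    assume z: "z \<in> {0<..}"
    show "((\<lambda>y. y powr - s) has_real_derivative - s * z powr (- s - 1)) (at z)"
      using z by (auto intro!: derivative_eq_intros)
    show "((\<lambda>z. - s * z powr (- s - 1)) has_real_derivative
            - s * ((- s - 1) * z powr (- s - 1 - 1))) (at z)"
      using z by (auto intro!: derivative_eq_intros)
    show "0 \<le> - s * ((- s - 1) * z powr (- s - 1 - 1))"
      using \<open>s > 0\<close> by (intro mult_nonpos_nonpos mult_nonpos_nonneg) auto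
  qed auto
  show "((\<lambda>y. y powr - s) has_real_derivative - s * x powr (- s - 1)) (at x within {0<..})"
    using \<open>x > 0\<close> by (auto intro!: derivative_eq_intros)
  show "connected ({0<..} :: real set)" by simp
qed (use assms in \<open>auto simp: interior_open\<close>)

text \<open>Comparison with the equation v' = -a v^(1+s), for which v^(-s) grows at the constant
  rate \<open>s * a\<close>. Since \<open>v\<close> is nonincreasing, \<open>v T > 0\<close> makes
  \<open>v\<close> positive on \<open>{0..T}\<close>, so negative powers are safe there; if
  \<open>v T = 0\<close>, the bound is trivial.\<close>

lemma dini_power_decay:
  fixes v :: "real \<Rightarrow> real"
  assumes cont: "continuous_on {0..} v"
    and nonneg: "\<And>t. t \<ge> 0 \<Longrightarrow> v t \<ge> 0"
    and "a \<ge> 0" "s > 0"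
    and dini: "\<And>t. t \<ge> 0 \<Longrightarrow>
      Limsup (at_right 0) (\<lambda>h. ereal ((v (t + h) - v t) / h)) \<le> ereal (- a * v t powr (1 + s))"
    and "T \<ge> 0"
  shows "v T powr s \<le> v 0 powr s / (1 + s * a * v 0 powr s * T)"
proof -
  have growth: "\<forall>\<^sub>F h in at_right 0. v (t + h) - v t \<le> (- a * v t powr (1 + s) + e) * h"
    if "t \<ge> 0" "e > 0" for t e
    using Limsup_at_right_quotient_le_imp[OF dini] that by blast
  have antimono: "v t' \<le> v t" if "0 \<le> t" "t \<le> t'" for t t'
  proof -
    have "v t' - v t \<le> 0 * (t' - t)"
    proof (rule right_growth_le[OF \<open>t \<le> t'\<close>])
      show "continuous_on {t..t'} v"
        using that by (intro continuous_on_subset[OF cont]) auto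
      fix z e :: real
      assume z: "t \<le> z" "z < t'" "e > 0"
      have "- a * v z powr (1 + s) \<le> 0"
        using \<open>a \<ge> 0\<close> by simp
      have "\<forall>\<^sub>F h in at_right (0::real). 0 < h"
        by (simp add: eventually_at_right_less)
      moreover have "\<forall>\<^sub>F h in at_right 0. v (z + h) - v z \<le> (- a * v z powr (1 + s) + e) * h"
        using growth z that by simp
      ultimately show "\<forall>\<^sub>F h in at_right 0. v (z + h) - v z \<le> (0 + e) * h"
      proof eventually_elim
        case (elim h)
        have "(- a * v z powr (1 + s) + e) * h \<le> (0 + e) * h"
          using \<open>- a * v z powr (1 + s) \<le> 0\<close> elim by (intro mult_right_mono add_right_mono) auto
        with elim show ?case
          by linarith
      qed
    qed
    then show ?thesis by simp
  qed
  show ?thesis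
  proof (cases "v T = 0")
    case True
    then show ?thesis
      using \<open>a \<ge> 0\<close> \<open>s > 0\<close> \<open>T \<ge> 0\<close> by simp
  next
    case False
    then have "v T > 0"
      using nonneg[OF \<open>T \<ge> 0\<close>] by simp
    then have pos: "v t > 0" if "0 \<le> t" "t \<le> T" for t
      using antimono[OF that] by simp
    have "(- (v T powr - s)) - (- (v 0 powr - s)) \<le> - (s * a) * (T - 0)"
    proof (rule right_growth_le[OF \<open>T \<ge> 0\<close>])
      show "continuous_on {0..T} (\<lambda>t. - (v t powr - s))"
        using pos by (intro continuous_intros continuous_on_subset[OF cont]) force+
      fix t e :: real
      assume t: "0 \<le> t" "t < T" "e > 0"
      \<comment> \<open>The slope of -z^(-s) at z = \<open>v t\<close>. Increments of -v^(-s) are at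
        most \<open>\<kappa>\<close> times those of \<open>v\<close>, so slack
        \<open>e / \<kappa>\<close> for \<open>v\<close> becomes slack \<open>e\<close>.\<close>
      define \<kappa> where "\<kappa> = s * v t powr (- s - 1)"
      have "v t > 0"
        using pos t by simp
      then have "\<kappa> > 0"
        using \<open>s > 0\<close> by (simp add: \<kappa>_def)
      have \<kappa>: "\<kappa> * (a * v t powr (1 + s)) = s * a"
        using \<open>v t > 0\<close> by (simp add: \<kappa>_def powr_add[symmetric])
      have "\<forall>\<^sub>F h in at_right 0. h < T - t"
        using t by (intro order_tendstoD(2)[OF tendsto_ident_at]) auto
      moreover have "\<forall>\<^sub>F h in at_right (0::real). 0 < h"
        by (simp add: eventually_at_right_less)
      moreover have "\<forall>\<^sub>F h in at_right 0.
          v (t + h) - v t \<le> (- a * v t powr (1 + s) + e / \<kappa>) * h"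
        using growth t \<open>\<kappa> > 0\<close> by simp
      ultimately show "\<forall>\<^sub>F h in at_right 0.
          - (v (t + h) powr - s) - - (v t powr - s) \<le> (- (s * a) + e) * h"
      proof eventually_elim
        case (elim h)
        have "- (v (t + h) powr - s) - - (v t powr - s) \<le> \<kappa> * (v (t + h) - v t)"
          using powr_minus_tangent_le[of "v t" "v (t + h)" s] pos[of "t + h"]
            \<open>v t > 0\<close> \<open>s > 0\<close> elim t by (simp add: \<kappa>_def)
        also have "\<dots> \<le> \<kappa> * ((- a * v t powr (1 + s) + e / \<kappa>) * h)"
          using elim \<open>\<kappa> > 0\<close> by (intro mult_left_mono) auto
        also have "\<dots> = (- (\<kappa> * (a * v t powr (1 + s))) + e) * h"
          using \<open>\<kappa> > 0\<close> by (simp add: field_simps)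
        finally show ?case
          by (simp only: \<kappa>)
      qed
    qed
    then have le: "v 0 powr - s + s * a * T \<le> v T powr - s"
      by simp
    define A where "A = v 0 powr s"
    define B where "B = v T powr s"
    have AB: "A > 0" "B > 0"
      using pos[of 0] \<open>v T > 0\<close> \<open>T \<ge> 0\<close> by (auto simp: A_def B_def)
    have "1 / A + s * a * T \<le> 1 / B"
      using le by (simp add: A_def B_def powr_minus_divide)
    then have "B * (1 + s * a * A * T) \<le> A"
      using AB by (simp add: field_simps)
    moreover have "1 + s * a * A * T > 0"
      using AB \<open>a \<ge> 0\<close> \<open>s > 0\<close> \<open>T \<ge> 0\<close> by (intro add_pos_nonneg mult_nonneg_nonneg) auto
    ultimately show ?thesis
      unfolding A_def[symmetric] B_def[symmetric] by (simp add: pos_le_divide_eq)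
  qed
qed

subsection \<open>The flow\<close>

lemma flow_eq_solution:
  assumes "well_posed_on \<Omega> f G" "x \<in> G" "solves_ivp \<Omega> f x y" "t \<ge> 0"
  shows "flow \<Omega> f x t = y t"
  unfolding flow_def
proof (rule the_equality)
  show "\<exists>y'. solves_ivp \<Omega> f x y' \<and> y' t = y t"
    using assms(3) by blast
  show "z = y t" if "\<exists>y'. solves_ivp \<Omega> f x y' \<and> y' t = z" for z
    using that assms unfolding well_posed_on_def by metis
qed

lemma flow_0:
  assumes "well_posed_on \<Omega> f G" "x \<in> G"
  shows "flow \<Omega> f x 0 = x"
proof -
  obtain y where y: "solves_ivp \<Omega> f x y"
    using assms unfolding well_posed_on_def by blast
  then show ?thesis
    using flow_eq_solution[OF assms y, of 0] by (simp add: solves_ivp_def)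
qed

lemma solves_ivp_shift:
  assumes y: "solves_ivp \<Omega> f x y" and "t \<ge> 0"
  shows "solves_ivp \<Omega> f (y t) (\<lambda>h. y (t + h))"
  unfolding solves_ivp_def
proof (intro conjI allI impI)
  fix h :: real
  assume "h \<ge> 0"
  show "y (t + h) \<in> \<Omega>"
    using y \<open>t \<ge> 0\<close> \<open>h \<ge> 0\<close> by (simp add: solves_ivp_def)
  have "((+) t has_vector_derivative 1) (at h within {0..})"
    by (auto intro!: derivative_eq_intros)
  \<comment> \<open>The chain rule wants the derivative of \<open>y\<close> within the shifted
    half-line starting at \<open>t\<close>, so that at \<open>h = 0\<close> it is again
    one-sided.\<close>
  moreover have "(y has_vector_derivative f (y (t + h))) (at (t + h) within (+) t ` {0..})"
  proof (rule has_vector_derivative_within_subset)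
    show "(y has_vector_derivative f (y (t + h))) (at (t + h) within {0..})"
      using y \<open>t \<ge> 0\<close> \<open>h \<ge> 0\<close> by (simp add: solves_ivp_def)
    show "(+) t ` {0..} \<subseteq> {0..}"
      using \<open>t \<ge> 0\<close> by auto
  qed
  ultimately have "(y \<circ> (+) t has_vector_derivative 1 *\<^sub>R f (y (t + h))) (at h within {0..})"
    by (rule vector_diff_chain_within)
  then show "((\<lambda>h. y (t + h)) has_vector_derivative f (y (t + h))) (at h within {0..})"
    by (simp add: o_def)
qed simp

text \<open>The shifted solution solves the problem from \<open>flow \<Omega> f x t\<close>, and
  forward invariance keeps that point in \<open>G\<close>, where uniqueness is assumed.\<close>

lemma flow_flow:
  assumes wp: "well_posed_on \<Omega> f G" and inv: "forward_invariant \<Omega> f G"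
    and "x \<in> G" "t \<ge> 0" "h \<ge> 0"
  shows "flow \<Omega> f (flow \<Omega> f x t) h = flow \<Omega> f x (t + h)"
proof -
  obtain y where y: "solves_ivp \<Omega> f x y"
    using wp \<open>x \<in> G\<close> unfolding well_posed_on_def by blast
  have "flow \<Omega> f x t = y t"
    using flow_eq_solution wp y assms by blast
  moreover have "flow \<Omega> f x t \<in> G"
    using inv assms by (simp add: forward_invariant_def)
  ultimately have "flow \<Omega> f (flow \<Omega> f x t) h = y (t + h)"
    using flow_eq_solution[OF wp _ solves_ivp_shift[OF y \<open>t \<ge> 0\<close>] \<open>h \<ge> 0\<close>] by simp
  then show ?thesis
    using flow_eq_solution[OF wp \<open>x \<in> G\<close> y] assms by simp
qed

lemma continuous_on_flow_time:
  assumes "well_posed_on \<Omega> f G" "x \<in> G"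
  shows "continuous_on {0..} (flow \<Omega> f x)"
proof -
  have "continuous_on {0..} ((\<lambda>(x, t). flow \<Omega> f x t) \<circ> Pair x)"
    using assms unfolding well_posed_on_def
    by (intro continuous_on_compose continuous_intros)
      (auto intro: continuous_on_subset)
  then show ?thesis
    by (simp add: o_def)
qed

subsection \<open>From Lyapunov functions to rational stability\<close>

text \<open>For positive \<open>a\<close> the quotient is 1/(1/a + c). This monotonicity lets an
  upper bound on the initial value be inserted in numerator and denominator at once.\<close>

lemma quotient_one_plus_mono:
  fixes a b c :: real
  assumes "0 \<le> a" "a \<le> b" "c \<ge> 0"
  shows "a / (1 + c * a) \<le> b / (1 + c * b)"
proof -
  have "1 + c * a > 0" "1 + c * b > 0"
    using assms by (auto intro!: add_pos_nonneg)
  then show ?thesis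
    using assms by (simp add: divide_simps algebra_simps)
qed

text \<open>Scalar decay applies to \<open>V\<close> along a trajectory. The upper bound on
  \<open>V\<close> at \<open>x\<close> contributes the factor \<open>c2 powr s\<close> to both gain
  and rate; the lower bound at time \<open>t\<close> contributes \<open>1 / c1 powr s\<close> to the
  gain.\<close>

lemma lyapunov_iii_imp_rational_estimate:
  assumes wp: "well_posed_on \<Omega> f G" and inv: "forward_invariant \<Omega> f G"
    and lyap: "lyapunov_iii \<Omega> f G c1 c2 c3 r s"
  shows "rational_estimate \<Omega> f G (r * s) (s * c3 * c2 powr s) ((c2 / c1) powr s)"
  unfolding rational_estimate_def
proof (intro ballI allI impI)
  fix x and t :: real
  assume "x \<in> G" "t \<ge> 0"
  have c: "c1 > 0" "c2 > 0" "c3 \<ge> 0" "r > 0" "s > 0"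
    using lyap by (auto simp: lyapunov_iii_def)
  obtain V where contV: "continuous_on G V"
    and V: "\<And>x. x \<in> G \<Longrightarrow> V x \<ge> 0 \<and> c1 * norm x powr r \<le> V x \<and> V x \<le> c2 * norm x powr r \<and>
      dini_deriv \<Omega> f V x \<le> ereal (- c3 * V x powr (1 + s))"
    using lyap by (auto simp: lyapunov_iii_def)
  define v where "v = (\<lambda>t. V (flow \<Omega> f x t))"
  have flow_in: "flow \<Omega> f x t \<in> G" if "t \<ge> 0" for t
    using inv \<open>x \<in> G\<close> that by (simp add: forward_invariant_def)
  have decay: "v t powr s \<le> v 0 powr s / (1 + s * c3 * v 0 powr s * t)"
  proof (rule dini_power_decay[OF _ _ \<open>c3 \<ge> 0\<close> \<open>s > 0\<close> _ \<open>t \<ge> 0\<close>])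
    show "continuous_on {0..} v"
      unfolding v_def using flow_in
      by (intro continuous_on_compose2[OF contV continuous_on_flow_time[OF wp \<open>x \<in> G\<close>]]) auto
    show "v t \<ge> 0" if "t \<ge> 0" for t
      using V flow_in that by (simp add: v_def)
    show "Limsup (at_right 0) (\<lambda>h. ereal ((v (t + h) - v t) / h))
        \<le> ereal (- c3 * v t powr (1 + s))" if "t \<ge> 0" for t
    proof -
      have "\<forall>\<^sub>F h in at_right (0::real). 0 < h"
        by (simp add: eventually_at_right_less)
      \<comment> \<open>The semigroup law identifies the right quotient of \<open>v\<close> at time
        \<open>t\<close> with the quotient defining \<open>dini_deriv\<close> at the point reached
        at time \<open>t\<close>.\<close>
      then have "\<forall>\<^sub>F h in at_right 0. ereal ((v (t + h) - v t) / h) =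
          ereal ((V (flow \<Omega> f (flow \<Omega> f x t) h) - V (flow \<Omega> f x t)) / h)"
        by eventually_elim (simp add: v_def flow_flow[OF wp inv \<open>x \<in> G\<close> that])
      then have "Limsup (at_right 0) (\<lambda>h. ereal ((v (t + h) - v t) / h)) =
          dini_deriv \<Omega> f V (flow \<Omega> f x t)"
        unfolding dini_deriv_def by (rule Limsup_eq)
      then show ?thesis
        using V[OF flow_in[OF that]] by (simp add: v_def)
    qed
  qed
  define A where "A = v 0 powr s"
  define N where "N = norm x powr (r * s)"
  define N' where "N' = norm (flow \<Omega> f x t) powr (r * s)"
  have "A \<le> (c2 * norm x powr r) powr s"
    unfolding A_def v_def using V[OF \<open>x \<in> G\<close>] \<open>s > 0\<close>
    by (auto simp: flow_0[OF wp \<open>x \<in> G\<close>] intro!: powr_mono2)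
  then have A: "0 \<le> A" "A \<le> c2 powr s * N"
    using c by (simp_all add: A_def N_def powr_mult powr_powr)
  have "(c1 * norm (flow \<Omega> f x t) powr r) powr s \<le> v t powr s"
    unfolding v_def using V[OF flow_in[OF \<open>t \<ge> 0\<close>]] c by (auto intro!: powr_mono2)
  then have "c1 powr s * N' \<le> v t powr s"
    using c by (simp add: N'_def powr_mult powr_powr)
  also have "\<dots> \<le> A / (1 + s * c3 * A * t)"
    using decay by (simp add: A_def)
  also have "\<dots> \<le> c2 powr s * N / (1 + s * c3 * (c2 powr s * N) * t)"
  proof -
    define b where "b = s * c3 * t"
    have "b \<ge> 0"
      using c \<open>t \<ge> 0\<close> by (simp add: b_def)
    have "A / (1 + b * A) \<le> (c2 powr s * N) / (1 + b * (c2 powr s * N))"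
      using A \<open>b \<ge> 0\<close> by (intro quotient_one_plus_mono)
    then show ?thesis
      by (simp add: b_def mult_ac)
  qed
  finally have "N' \<le> c2 powr s * N / (1 + s * c3 * (c2 powr s * N) * t) / c1 powr s"
    using c by (subst pos_le_divide_eq) (simp_all add: mult.commute[of N'])
  then show "norm (flow \<Omega> f x t) powr (r * s)
      \<le> (c2 / c1) powr s * (norm x powr (r * s) / (1 + norm x powr (r * s) * (s * c3 * c2 powr s) * t))"
    unfolding N_def[symmetric] N'_def[symmetric] using c
    by (simp add: powr_divide mult_ac)
qed

lemma rational_estimate_imp_rationally_stable:
  assumes "rational_estimate \<Omega> f G p k M" "p > 0" "k > 0" "M \<ge> 1"
  shows "rationally_stable \<Omega> f G p k M"
  using assms by (simp add: rationally_stable_def)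

lemma rational_estimate_mono_rate:
  assumes est: "rational_estimate \<Omega> f G p k M" and "0 \<le> k'" "k' \<le> k" "M \<ge> 0"
  shows "rational_estimate \<Omega> f G p k' M"
  unfolding rational_estimate_def
proof (intro ballI allI impI)
  fix x and t :: real
  assume "x \<in> G" "t \<ge> 0"
  then have "norm (flow \<Omega> f x t) powr p \<le> M * (norm x powr p / (1 + norm x powr p * k * t))"
    using est by (simp add: rational_estimate_def)
  also have "\<dots> \<le> M * (norm x powr p / (1 + norm x powr p * k' * t))"
    using assms \<open>t \<ge> 0\<close>
    by (intro mult_left_mono divide_left_mono add_left_mono mult_right_mono mult_pos_pos
        add_pos_nonneg mult_nonneg_nonneg) auto
  finally show "norm (flow \<Omega> f x t) powr p \<le> M * (norm x powr p / (1 + norm x powr p * k' * t))" .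
qed

text \<open>At a nonzero point the factor \<open>norm x powr r\<close> is positive and cancels. At
  the origin both bounds are 0 and compare nothing, so gain at least 1 is derived only when
  \<open>G\<close> has a nonzero point.\<close>

lemma bounds_le_of_nonzero_point:
  fixes V :: "'a::real_normed_vector \<Rightarrow> real"
  assumes "\<not> G \<subseteq> {0}" and "\<And>x. x \<in> G \<Longrightarrow> a * norm x powr r \<le> V x \<and> V x \<le> b * norm x powr r"
  shows "a \<le> b"
proof -
  obtain x where "x \<in> G" "x \<noteq> 0"
    using assms(1) by blast
  then have "a * norm x powr r \<le> b * norm x powr r" "norm x powr r > 0"
    using assms(2)[of x] by (blast intro: order_trans, simp)
  then show ?thesis
    by simp
qed

lemma lyapunov_iii_bounds_le:
  assumes "lyapunov_iii \<Omega> f G c1 c2 c3 r s" "\<not> G \<subseteq> {0}"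
  shows "c1 \<le> c2"
  using assms bounds_le_of_nonzero_point[of G c1 r _ c2] unfolding lyapunov_iii_def by metis

lemma lyapunov_iii_gain_ge_1:
  assumes "lyapunov_iii \<Omega> f G c1 c2 c3 r s" "\<not> G \<subseteq> {0}"
  shows "(c2 / c1) powr s \<ge> 1"
proof -
  have "c1 > 0" "s > 0"
    using assms(1) by (auto simp: lyapunov_iii_def)
  then show ?thesis
    using lyapunov_iii_bounds_le[OF assms] by (simp add: ge_one_powr_ge_zero)
qed

lemma lyapunov_iii_imp_rationally_stable:
  assumes "well_posed_on \<Omega> f G" "forward_invariant \<Omega> f G"
    and lyap: "lyapunov_iii \<Omega> f G c1 c2 c3 r s" and "c3 > 0" "\<not> G \<subseteq> {0}"
  shows "rationally_stable \<Omega> f G (r * s) (s * c3 * c2 powr s) ((c2 / c1) powr s)"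
proof (rule rational_estimate_imp_rationally_stable)
  have "c2 > 0" "r > 0" "s > 0"
    using lyap by (auto simp: lyapunov_iii_def)
  then show "r * s > 0" "s * c3 * c2 powr s > 0"
    using \<open>c3 > 0\<close> by auto
  show "rational_estimate \<Omega> f G (r * s) (s * c3 * c2 powr s) ((c2 / c1) powr s)"
    by (rule lyapunov_iii_imp_rational_estimate[OF assms(1-3)])
  show "(c2 / c1) powr s \<ge> 1"
    by (rule lyapunov_iii_gain_ge_1[OF lyap assms(5)])
qed

section \<open>Reduction of (i) and (ii) to (iii)\<close>

text \<open>The upper bound on \<open>V\<close> gives \<open>norm x powr q\<close> at least (V x /
  C2)^(q/r); matching the exponent with 1 + s gives s = q/r - 1.\<close>

lemma lyapunov_i_imp_iii:
  assumes "lyapunov_i \<Omega> f G C1 C2 C3 q r"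
  shows "lyapunov_iii \<Omega> f G C1 C2 (C3 / C2 powr (q / r)) r (q / r - 1)"
proof -
  have c: "C1 > 0" "C2 > 0" "C3 \<ge> 0" "q > r" "r > 0"
    using assms by (auto simp: lyapunov_i_def)
  obtain V where contV: "continuous_on G V"
    and V: "\<And>x. x \<in> G \<Longrightarrow> V x \<ge> 0 \<and> C1 * norm x powr r \<le> V x \<and> V x \<le> C2 * norm x powr r \<and>
      dini_deriv \<Omega> f V x \<le> ereal (- C3 * norm x powr q)"
    using assms by (auto simp: lyapunov_i_def)
  have "dini_deriv \<Omega> f V x \<le> ereal (- (C3 / C2 powr (q / r)) * V x powr (1 + (q / r - 1)))"
    if "x \<in> G" for x
  proof -
    have "V x powr (q / r) \<le> (C2 * norm x powr r) powr (q / r)"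
      using V[OF that] c by (intro powr_mono2) auto
    also have "\<dots> = C2 powr (q / r) * norm x powr q"
      using c by (simp add: powr_mult powr_powr)
    finally have "V x powr (q / r) / C2 powr (q / r) \<le> norm x powr q"
      using c by (simp add: field_simps)
    then have "C3 * (V x powr (q / r) / C2 powr (q / r)) \<le> C3 * norm x powr q"
      using c by (intro mult_left_mono)
    then show ?thesis
      using V[OF that] by (auto elim!: order_trans)
  qed
  with c contV V show ?thesis
    unfolding lyapunov_iii_def by (auto intro!: exI[of _ V])
qed

text \<open>The factor \<open>V x\<close> stays, and the upper bound trades
  \<open>norm x powr p\<close> for \<open>V x powr (p / r)\<close>.\<close>

lemma lyapunov_ii_imp_iii:
  assumes "lyapunov_ii \<Omega> f G c \<gamma> p r"
  shows "lyapunov_iii \<Omega> f G (inverse \<gamma>) 1 c r (p / r)"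
proof -
  have c: "c \<ge> 0" "\<gamma> > 0" "p > 0" "r > 0"
    using assms by (auto simp: lyapunov_ii_def)
  obtain V where contV: "continuous_on G V"
    and V: "\<And>x. x \<in> G \<Longrightarrow> V x \<ge> 0 \<and> inverse \<gamma> * norm x powr r \<le> V x \<and> V x \<le> norm x powr r \<and>
      dini_deriv \<Omega> f V x \<le> ereal (- c * V x * norm x powr p)"
    using assms by (auto simp: lyapunov_ii_def)
  have "dini_deriv \<Omega> f V x \<le> ereal (- c * V x powr (1 + p / r))" if "x \<in> G" for x
  proof -
    have "V x powr (p / r) \<le> (norm x powr r) powr (p / r)"
      using V[OF that] c by (intro powr_mono2) auto
    also have "\<dots> = norm x powr p"
      using c by (simp add: powr_powr)
    finally have "c * V x * V x powr (p / r) \<le> c * V x * norm x powr p"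
      using c V[OF that] by (intro mult_left_mono) auto
    moreover have "V x * V x powr (p / r) = V x powr (1 + p / r)"
      using V[OF that] by (simp add: powr_add)
    ultimately show ?thesis
      using V[OF that] by (auto simp: mult.assoc elim!: order_trans)
  qed
  with c contV V show ?thesis
    unfolding lyapunov_iii_def by (auto intro!: exI[of _ V])
qed

subsection \<open>The converse Lyapunov function\<close>

text \<open>Multiplied out, the estimate reads u + k t u N <= M N. Subtracting l t u N from both
  sides rearranges to the second claim; the first makes its denominator positive.\<close>

lemma rational_quotient_bounds:
  fixes u N M k l t :: real
  assumes "u \<ge> 0" "N \<ge> 0" "M > 0" "0 \<le> l" "l < k" "t \<ge> 0"
    and le: "u \<le> M * (N / (1 + N * k * t))"
  shows "l * t * u < M" and "u / (M - l * t * u) \<le> N / (1 + (k - l) * t * N)"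
proof -
  have "1 + N * k * t > 0"
    using assms by (intro add_pos_nonneg mult_nonneg_nonneg) auto
  with le have ineq: "u + k * t * u * N \<le> M * N"
    by (simp add: field_simps)
  \<comment> \<open>For positive \<open>u\<close> the summand \<open>u\<close> makes the inequality
    strict before \<open>N\<close> is cancelled; \<open>N = 0\<close> forces
    \<open>u = 0\<close>.\<close>
  have "k * t * u < M"
  proof (cases "u = 0 \<or> N = 0")
    case True
    then show ?thesis
      using ineq assms by auto
  next
    case False
    then have "u > 0" "N > 0"
      using assms by auto
    then have "k * t * u * N < M * N" "N > 0"
      using ineq by linarith+
    then show ?thesis
      using mult_less_cancel_right_pos[of N "k * t * u" M] by blast
  qed
  moreover have "l * t * u \<le> k * t * u"
    using assms by (intro mult_right_mono) auto
  ultimately show less: "l * t * u < M"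
    by simp
  have "1 + (k - l) * t * N > 0"
    using assms by (intro add_pos_nonneg mult_nonneg_nonneg) auto
  with less have "u / (M - l * t * u) \<le> N / (1 + (k - l) * t * N) \<longleftrightarrow>
      u * (1 + (k - l) * t * N) \<le> N * (M - l * t * u)"
    by (simp add: pos_divide_le_eq pos_le_divide_eq)
  also have "\<dots>"
    using ineq by (simp add: algebra_simps)
  finally show "u / (M - l * t * u) \<le> N / (1 + (k - l) * t * N)" .
qed

text \<open>
  Taking reciprocals, \<open>1 / V x\<close> is the infimum over \<open>t \<ge> 0\<close> of
  \<open>M / norm (flow \<Omega> f x t) powr p - l * t\<close>, which increases at rate at least \<open>l\<close> along solutions.
\<close>

lemma rationally_stable_imp_lyapunov_iii:
  assumes wp: "well_posed_on \<Omega> f G" and inv: "forward_invariant \<Omega> f G"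
    and stable: "rationally_stable \<Omega> f G p k M" and l: "0 \<le> l" "l < k"
  shows "lyapunov_iii \<Omega> f G (1 / M) 1 l p 1"
proof -
  have "p > 0" "k > 0" "M \<ge> 1"
    and est: "\<And>x t. x \<in> G \<Longrightarrow> t \<ge> 0 \<Longrightarrow>
      norm (flow \<Omega> f x t) powr p \<le> M * (norm x powr p / (1 + norm x powr p * k * t))"
    using stable by (auto simp: rationally_stable_def rational_estimate_def)
  define N where "N = (\<lambda>x :: real ^ 'a. norm x powr p)"
  define u where "u = (\<lambda>x t. N (flow \<Omega> f x t))"
  \<comment> \<open>This is the reciprocal of M/u - l t for positive \<open>u\<close>, in a form
    that also gives the right value 0 when \<open>u\<close> vanishes.\<close>
  define F where "F = (\<lambda>x t. u x t / (M - l * t * u x t))"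
  define V where "V = (\<lambda>x. SUP t\<in>{0..}. F x t)"
  have N_nonneg: "N x \<ge> 0" for x
    by (simp add: N_def)
  have u_nonneg: "u x t \<ge> 0" for x t
    by (simp add: u_def N_nonneg)
  have denom: "l * t * u x t < M" and F_le: "F x t \<le> N x / (1 + (k - l) * t * N x)"
    if "x \<in> G" "t \<ge> 0" for x t
    using rational_quotient_bounds[of "u x t" "N x" M l k t] est[OF that] l \<open>M \<ge> 1\<close> that
    by (simp_all add: u_def N_def F_def)
  have F_nonneg: "F x t \<ge> 0" if "x \<in> G" "t \<ge> 0" for x t
    using denom[OF that] by (simp add: F_def u_nonneg)
  have F_0: "F x 0 = N x / M" if "x \<in> G" for x
    using flow_0[OF wp that] by (simp add: F_def u_def)
  have F_le_N: "F x t \<le> N x" if "x \<in> G" "t \<ge> 0" for x t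
  proof -
    have "(k - l) * t * N x \<ge> 0"
      using l that N_nonneg[of x] by simp
    then have "N x / (1 + (k - l) * t * N x) \<le> N x"
      using N_nonneg[of x] by (simp add: divide_le_eq mult_le_cancel_left1)
    then show ?thesis
      using F_le[OF that] by simp
  qed
  have F_le_V: "F x t \<le> V x" if "x \<in> G" "t \<ge> 0" for x t
    unfolding V_def using that F_le_N by (intro cSUP_upper bdd_aboveI2[of _ _ "N x"]) auto
  have V_le: "V x \<le> b" if "\<And>t. t \<ge> 0 \<Longrightarrow> F x t \<le> b" for x b
    unfolding V_def using that by (intro cSUP_least) auto
  have V_nonneg: "V x \<ge> 0" if "x \<in> G" for x
    using F_nonneg[OF that, of 0] F_le_V[OF that, of 0] by simp
  have V_lower: "N x / M \<le> V x" if "x \<in> G" for x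
    using F_le_V[OF that, of 0] F_0[OF that] by simp
  have V_upper: "V x \<le> N x" if "x \<in> G" for x
    using that F_le_N by (intro V_le)

  have contN: "continuous_on UNIV N"
    unfolding N_def using \<open>p > 0\<close> by (intro continuous_on_powr' continuous_intros) auto
  have contF: "continuous_on (G \<times> {0..}) (\<lambda>(x, t). F x t)"
  proof -
    have "continuous_on (G \<times> {0..}) (\<lambda>z. N (case z of (x, t) \<Rightarrow> flow \<Omega> f x t))"
      using wp unfolding well_posed_on_def
      by (intro continuous_on_compose2[OF contN]) auto
    then have "continuous_on (G \<times> {0..}) (\<lambda>z. u (fst z) (snd z))"
      by (simp add: u_def case_prod_unfold)
    then have "continuous_on (G \<times> {0..}) (\<lambda>z. F (fst z) (snd z))"
      unfolding F_def using denom by (intro continuous_intros) fastforce+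
    then show ?thesis
      by (simp add: case_prod_unfold)
  qed
  have contV: "continuous_on G V"
    unfolding continuous_on_def
  proof
    fix x0
    assume "x0 \<in> G"
    have N_tendsto: "(N \<longlongrightarrow> N x0) (at x0 within G)"
      using contN \<open>x0 \<in> G\<close> by (meson UNIV_I continuous_on_def tendsto_within_subset subset_UNIV)
    have ev_G: "\<forall>\<^sub>F x in at x0 within G. x \<in> G"
      by (simp add: eventually_at_filter)
    show "(V \<longlongrightarrow> V x0) (at x0 within G)"
    \<comment> \<open>At the origin \<open>V\<close> is squeezed between 0 and \<open>N\<close>;
      elsewhere the supremum is localized to a compact time interval.\<close>
    proof (cases "N x0 = 0")
      case True
      then have "V x0 = 0"
        using V_nonneg V_upper \<open>x0 \<in> G\<close> by force
      moreover have "(V \<longlongrightarrow> 0) (at x0 within G)"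
      proof (rule tendsto_sandwich[OF _ _ tendsto_const])
        show "(N \<longlongrightarrow> 0) (at x0 within G)"
          using N_tendsto True by simp
        show "\<forall>\<^sub>F x in at x0 within G. 0 \<le> V x"
          using ev_G by eventually_elim (rule V_nonneg)
        show "\<forall>\<^sub>F x in at x0 within G. V x \<le> N x"
          using ev_G by eventually_elim (rule V_upper)
      qed
      ultimately show ?thesis
        by simp
    next
      case False
      then have "N x0 > 0"
        using N_nonneg[of x0] by simp
      \<comment> \<open>Chosen so that (k - l) t N x >= M - 1 whenever \<open>t \<ge> T\<close> and
        \<open>N x > N x0 / 2\<close>. Then \<open>F_le\<close> bounds \<open>F x t\<close> by
        \<open>N x / M\<close>, which is \<open>F x 0\<close>: late times never beat time 0.\<close>
      define T where "T = 2 * (M - 1) / ((k - l) * N x0)"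
      have "T \<ge> 0"
        using l \<open>M \<ge> 1\<close> \<open>N x0 > 0\<close> by (simp add: T_def)
      have late: "F x t \<le> F x 0" if "x \<in> G" "N x > N x0 / 2" "t \<ge> T" for x t
      proof -
        have "N x > 0"
          using that \<open>N x0 > 0\<close> by simp
        have "M - 1 = (k - l) * T * (N x0 / 2)"
          using l \<open>N x0 > 0\<close> by (simp add: T_def)
        also have "\<dots> \<le> (k - l) * t * N x"
          using that l \<open>T \<ge> 0\<close> \<open>N x0 > 0\<close> by (intro mult_mono) auto
        finally have "N x / (1 + (k - l) * t * N x) \<le> N x / M"
          using \<open>N x > 0\<close> \<open>M \<ge> 1\<close> by (intro divide_left_mono) auto
        then show ?thesis
          using F_le[of x t] F_0 that \<open>T \<ge> 0\<close> by simp
      qed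
      show ?thesis
      proof (rule tendstoI)
        fix e :: real
        assume "e > 0"
        then have "e / 2 > 0"
          by simp
        have contT: "continuous_on (G \<times> {0..T}) (\<lambda>(x, t). F x t)"
          by (rule continuous_on_subset[OF contF]) auto
        \<comment> \<open>Compactness of \<open>{0..T}\<close> gives one neighbourhood that serves
          all times up to \<open>T\<close>; later times are compared through time 0.\<close>
        obtain X where X: "x0 \<in> X" "open X"
          and close: "\<forall>x\<in>X \<inter> G. \<forall>t\<in>{0..T}.
            dist (case (x, t) of (x, t) \<Rightarrow> F x t) (case (x0, t) of (x, t) \<Rightarrow> F x t) \<le> e / 2"
          by (rule continuous_on_prod_compactE[OF contT compact_Icc \<open>x0 \<in> G\<close> \<open>e / 2 > 0\<close>])
        have "\<forall>\<^sub>F x in at x0 within G. x \<in> X"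
          using X by (simp add: eventually_at_topological) blast
        moreover have "\<forall>\<^sub>F x in at x0 within G. N x > N x0 / 2"
          using order_tendstoD(1)[OF N_tendsto, of "N x0 / 2"] \<open>N x0 > 0\<close> by simp
        ultimately show "\<forall>\<^sub>F x in at x0 within G. dist (V x) (V x0) < e"
          using ev_G
        proof eventually_elim
          case (elim x)
          have near: "\<bar>F x t - F x0 t\<bar> \<le> e / 2" if "0 \<le> t" "t \<le> T" for t
            using close elim that by (auto simp: dist_real_def)
          have "V x \<le> V x0 + e / 2"
          proof (rule V_le)
            fix t :: real
            assume "t \<ge> 0"
            show "F x t \<le> V x0 + e / 2"
            proof (cases "t \<le> T")
              case True
              then show ?thesis
                using near[OF \<open>t \<ge> 0\<close>] F_le_V[OF \<open>x0 \<in> G\<close> \<open>t \<ge> 0\<close>] by linarith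
            next
              case False
              then show ?thesis
                using near[of 0] F_le_V[OF \<open>x0 \<in> G\<close>, of 0] late[of x t] elim \<open>T \<ge> 0\<close> by linarith
            qed
          qed
          moreover have "V x0 \<le> V x + e / 2"
          proof (rule V_le)
            fix t :: real
            assume "t \<ge> 0"
            show "F x0 t \<le> V x + e / 2"
            proof (cases "t \<le> T")
              case True
              then show ?thesis
                using near[OF \<open>t \<ge> 0\<close>] F_le_V[OF \<open>x \<in> G\<close> \<open>t \<ge> 0\<close>] by linarith
            next
              case False
              then show ?thesis
                using near[of 0] F_le_V[OF \<open>x \<in> G\<close>, of 0] late[of x0 t] \<open>x0 \<in> G\<close> \<open>N x0 > 0\<close> \<open>T \<ge> 0\<close>
                by linarith
            qed
          qed
          ultimately show ?case
            using \<open>e > 0\<close> by (simp add: dist_real_def abs_le_iff)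
        qed
      qed
    qed
  qed

  \<comment> \<open>For positive values, the reciprocal of F at (flow x h, t) is that of F at (x, t
    + h) plus l h. The times t + h are among those in the supremum for \<open>x\<close>, and
    \<open>quotient_one_plus_mono\<close> passes to \<open>V x\<close>.\<close>
  have V_flow: "V (flow \<Omega> f x h) \<le> V x / (1 + l * h * V x)" if "x \<in> G" "h \<ge> 0" for x h
  proof (rule V_le)
    fix t :: real
    assume "t \<ge> 0"
    define U where "U = u x (t + h)"
    have "u (flow \<Omega> f x h) t = U"
      using flow_flow[OF wp inv \<open>x \<in> G\<close> \<open>h \<ge> 0\<close> \<open>t \<ge> 0\<close>] by (simp add: u_def U_def add.commute)
    then have "F (flow \<Omega> f x h) t = U / (M - l * t * U)"
      by (simp add: F_def)
    also have "\<dots> = F x (t + h) / (1 + l * h * F x (t + h))"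
    proof -
      have "M - l * (t + h) * U > 0"
        using denom[OF \<open>x \<in> G\<close>, of "t + h"] \<open>t \<ge> 0\<close> \<open>h \<ge> 0\<close> by (simp add: U_def)
      moreover have "1 + l * h * (U / (M - l * (t + h) * U)) =
          (M - l * t * U) / (M - l * (t + h) * U)"
        using calculation by (simp add: field_simps)
      ultimately show ?thesis
        by (simp add: F_def U_def[symmetric])
    qed
    also have "\<dots> \<le> V x / (1 + l * h * V x)"
      using that \<open>t \<ge> 0\<close> l by (intro quotient_one_plus_mono F_nonneg F_le_V) auto
    finally show "F (flow \<Omega> f x h) t \<le> V x / (1 + l * h * V x)" .
  qed
  have V_dini: "dini_deriv \<Omega> f V x \<le> ereal (- l * V x powr (1 + 1))" if "x \<in> G" for x
  proof -
    have "\<forall>\<^sub>F h in at_right (0::real). 0 < h"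
      by (simp add: eventually_at_right_less)
    \<comment> \<open>The bound on the quotient is continuous in \<open>h\<close> at 0, so its limit
      there bounds the Dini derivative.\<close>
    then have "\<forall>\<^sub>F h in at_right 0. ereal ((V (flow \<Omega> f x h) - V x) / h) \<le>
        ereal (- l * (V x)\<^sup>2 / (1 + l * h * V x))"
    proof eventually_elim
      case (elim h)
      have "1 + l * h * V x > 0"
        using l elim V_nonneg[OF that] by (intro add_pos_nonneg mult_nonneg_nonneg) auto
      then have "V x / (1 + l * h * V x) - V x = (- l * (V x)\<^sup>2 / (1 + l * h * V x)) * h"
        by (simp add: field_simps power2_eq_square)
      then have "V (flow \<Omega> f x h) - V x \<le> (- l * (V x)\<^sup>2 / (1 + l * h * V x)) * h"
        using V_flow[OF that, of h] elim by simp
      then show ?case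
        using elim by (simp add: pos_divide_le_eq)
    qed
    then have "dini_deriv \<Omega> f V x \<le>
        Limsup (at_right 0) (\<lambda>h. ereal (- l * (V x)\<^sup>2 / (1 + l * h * V x)))"
      unfolding dini_deriv_def by (rule Limsup_mono)
    also have "\<dots> = ereal (- l * (V x)\<^sup>2 / (1 + l * 0 * V x))"
      by (intro lim_imp_Limsup tendsto_intros) auto
    also have "(V x)\<^sup>2 = V x powr (1 + 1)"
      using V_nonneg[OF that] by (simp add: powr_numeral)
    finally show ?thesis
      by simp
  qed
  show ?thesis
    unfolding lyapunov_iii_def using \<open>M \<ge> 1\<close> \<open>p > 0\<close> l contV V_nonneg V_lower V_upper V_dini
    by (auto simp: N_def intro!: exI[of _ V])
qed

section \<open>From (iii) back to (ii) and (i)\<close>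

text \<open>The lower bound on \<open>V\<close> replaces one factor of V^2 by
  \<open>norm x powr p / M\<close>, which is where \<open>l / M\<close> comes from.\<close>

lemma lyapunov_iii_imp_ii:
  assumes "lyapunov_iii \<Omega> f G (1 / M) 1 l p 1"
  shows "lyapunov_ii \<Omega> f G (l / M) M p p"
proof -
  have c: "M > 0" "l \<ge> 0" "p > 0"
    using assms by (auto simp: lyapunov_iii_def)
  obtain V where contV: "continuous_on G V"
    and V: "\<And>x. x \<in> G \<Longrightarrow> V x \<ge> 0 \<and> 1 / M * norm x powr p \<le> V x \<and> V x \<le> 1 * norm x powr p \<and>
      dini_deriv \<Omega> f V x \<le> ereal (- l * V x powr (1 + 1))"
    using assms by (auto simp: lyapunov_iii_def)
  have "dini_deriv \<Omega> f V x \<le> ereal (- (l / M) * V x * norm x powr p)" if "x \<in> G" for x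
  proof -
    have "l * V x * (1 / M * norm x powr p) \<le> l * V x * V x"
      using V[OF that] c by (intro mult_left_mono) auto
    then have "- l * V x powr (1 + 1) \<le> - (l / M) * V x * norm x powr p"
      using V[OF that] by (simp add: powr_numeral power2_eq_square mult_ac)
    then show ?thesis
      using V[OF that] by (meson ereal_less_eq(3) order_trans)
  qed
  with c contV V show ?thesis
    unfolding lyapunov_ii_def by (auto simp: inverse_eq_divide intro!: exI[of _ V])
qed

text \<open>The lower bound replaces the remaining factor \<open>V x\<close>, at the cost of another
  division by \<open>\<gamma>\<close>. With \<open>\<gamma> = M\<close> and
  \<open>c = kbar / M\<close> this produces \<open>kbar / M\<^sup>2\<close>.\<close>

lemma lyapunov_ii_imp_i:
  assumes "lyapunov_ii \<Omega> f G c \<gamma> p r"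
  shows "lyapunov_i \<Omega> f G (1 / \<gamma>) 1 (c / \<gamma>) (r + p) r"
proof -
  have c: "c \<ge> 0" "\<gamma> > 0" "p > 0" "r > 0"
    using assms by (auto simp: lyapunov_ii_def)
  obtain V where contV: "continuous_on G V"
    and V: "\<And>x. x \<in> G \<Longrightarrow> V x \<ge> 0 \<and> inverse \<gamma> * norm x powr r \<le> V x \<and> V x \<le> norm x powr r \<and>
      dini_deriv \<Omega> f V x \<le> ereal (- c * V x * norm x powr p)"
    using assms by (auto simp: lyapunov_ii_def)
  have "dini_deriv \<Omega> f V x \<le> ereal (- (c / \<gamma>) * norm x powr (r + p))" if "x \<in> G" for x
  proof -
    have "c * (inverse \<gamma> * norm x powr r) * norm x powr p \<le> c * V x * norm x powr p"
      using V[OF that] c by (intro mult_left_mono mult_right_mono) auto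
    then have "- c * V x * norm x powr p \<le> - (c / \<gamma>) * norm x powr (r + p)"
      by (simp add: powr_add divide_inverse mult_ac)
    then show ?thesis
      using V[OF that] by (meson ereal_less_eq(3) order_trans)
  qed
  with c contV V show ?thesis
    unfolding lyapunov_i_def by (auto simp: inverse_eq_divide intro!: exI[of _ V])
qed

text \<open>The forward statements are split: the estimate covers rate 0 and
  \<open>G \<subseteq> {0}\<close>, while \<open>rationally_stable\<close> also asserts a positive
  rate and gain at least 1, obtained from a positive decay constant and a nonzero point of
  \<open>G\<close>.\<close>

theorem lemma9:
  fixes \<Omega> G :: "(real ^ 'n) set" and f :: "real ^ 'n \<Rightarrow> real ^ 'n"
  assumes "G \<subseteq> \<Omega>"
    and "well_posed_on \<Omega> f G"
    and "forward_invariant \<Omega> f G"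
  shows
    "(\<forall>C1 C2 C3 q r. lyapunov_i \<Omega> f G C1 C2 C3 q r \<longrightarrow>
        rational_estimate \<Omega> f G (q - r) ((q / r - 1) * (C3 / C2)) ((C2 / C1) powr (q / r - 1)) \<and>
        (C3 > 0 \<and> \<not> G \<subseteq> {0} \<longrightarrow>
         rationally_stable \<Omega> f G (q - r) ((q / r - 1) * (C3 / C2)) ((C2 / C1) powr (q / r - 1))))
   \<and> (\<forall>p k M kbar. rationally_stable \<Omega> f G p k M \<and> 0 \<le> kbar \<and> kbar < k \<longrightarrow>
        lyapunov_i \<Omega> f G (1 / M) 1 (kbar / M\<^sup>2) (2 * p) p)
   \<and> (\<forall>c \<gamma> p r. lyapunov_ii \<Omega> f G c \<gamma> p r \<longrightarrow>
        rational_estimate \<Omega> f G p (c * p / r) (\<gamma> powr (p / r)) \<and>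
        (c > 0 \<and> \<not> G \<subseteq> {0} \<longrightarrow>
         rationally_stable \<Omega> f G p (c * p / r) (\<gamma> powr (p / r))))
   \<and> (\<forall>p k M kbar. rationally_stable \<Omega> f G p k M \<and> 0 \<le> kbar \<and> kbar < k \<longrightarrow>
        lyapunov_ii \<Omega> f G (kbar / M) M p p)
   \<and> (\<forall>c1 c2 c3 r s. lyapunov_iii \<Omega> f G c1 c2 c3 r s \<longrightarrow>
        rational_estimate \<Omega> f G (r * s) (s * c3 * c2 powr s) ((c2 / c1) powr s) \<and>
        (c3 > 0 \<and> \<not> G \<subseteq> {0} \<longrightarrow>
         rationally_stable \<Omega> f G (r * s) (s * c3 * c2 powr s) ((c2 / c1) powr s)) \<and>
        (c2 \<ge> 1 \<longrightarrow>
         rational_estimate \<Omega> f G (r * s) (s * (c3 / c2 powr s)) ((c2 / c1) powr s)) \<and>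
        (c2 \<ge> 1 \<and> c3 > 0 \<and> \<not> G \<subseteq> {0} \<longrightarrow>
         rationally_stable \<Omega> f G (r * s) (s * (c3 / c2 powr s)) ((c2 / c1) powr s)))
   \<and> (\<forall>p k M kbar. rationally_stable \<Omega> f G p k M \<and> 0 \<le> kbar \<and> kbar < k \<longrightarrow>
        lyapunov_iii \<Omega> f G (1 / M) 1 kbar p 1)"
proof -
  note wp = assms(2) and inv = assms(3)
  \<comment> \<open>The reduction to (iii) divides by C2^(q/r) and the decay rate multiplies by
    C2^(q/r - 1), leaving a single 1/C2.\<close>
  have i_rate: "(q / r - 1) * (C3 / C2 powr (q / r)) * C2 powr (q / r - 1) = (q / r - 1) * (C3 / C2)"
    and i_power: "r * (q / r - 1) = q - r"
    if "lyapunov_i \<Omega> f G C1 C2 C3 q r" for C1 C2 C3 q r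
  proof -
    have "C2 > 0" "r > 0"
      using that by (auto simp: lyapunov_i_def)
    then show "(q / r - 1) * (C3 / C2 powr (q / r)) * C2 powr (q / r - 1) = (q / r - 1) * (C3 / C2)"
      by (simp add: powr_diff)
    show "r * (q / r - 1) = q - r"
      using \<open>r > 0\<close> by (simp add: right_diff_distrib)
  qed
  have i_est: "rational_estimate \<Omega> f G (q - r) ((q / r - 1) * (C3 / C2)) ((C2 / C1) powr (q / r - 1))"
    if "lyapunov_i \<Omega> f G C1 C2 C3 q r" for C1 C2 C3 q r
    using lyapunov_iii_imp_rational_estimate[OF wp inv lyapunov_i_imp_iii[OF that]]
    by (simp only: i_rate[OF that] i_power[OF that])
  have i_stable: "rationally_stable \<Omega> f G (q - r) ((q / r - 1) * (C3 / C2)) ((C2 / C1) powr (q / r - 1))"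
    if "lyapunov_i \<Omega> f G C1 C2 C3 q r" "C3 > 0" "\<not> G \<subseteq> {0}" for C1 C2 C3 q r
  proof -
    have "C3 / C2 powr (q / r) > 0"
      using that by (auto simp: lyapunov_i_def)
    from lyapunov_iii_imp_rationally_stable[OF wp inv lyapunov_i_imp_iii[OF that(1)] this that(3)]
    show ?thesis
      by (simp only: i_rate[OF that(1)] i_power[OF that(1)])
  qed
  have ii_params: "r * (p / r) = p" "p / r * c * 1 powr (p / r) = c * p / r" "1 / inverse \<gamma> = \<gamma>"
    if "lyapunov_ii \<Omega> f G c \<gamma> p r" for c \<gamma> p r
    using that by (simp_all add: lyapunov_ii_def field_simps)
  have ii_est: "rational_estimate \<Omega> f G p (c * p / r) (\<gamma> powr (p / r))"
    if "lyapunov_ii \<Omega> f G c \<gamma> p r" for c \<gamma> p r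
    using lyapunov_iii_imp_rational_estimate[OF wp inv lyapunov_ii_imp_iii[OF that]]
    by (simp only: ii_params[OF that])
  have ii_stable: "rationally_stable \<Omega> f G p (c * p / r) (\<gamma> powr (p / r))"
    if "lyapunov_ii \<Omega> f G c \<gamma> p r" "c > 0" "\<not> G \<subseteq> {0}" for c \<gamma> p r
    using lyapunov_iii_imp_rationally_stable[OF wp inv lyapunov_ii_imp_iii[OF that(1)] that(2,3)]
    by (simp only: ii_params[OF that(1)])
  note iii_est = lyapunov_iii_imp_rational_estimate[OF wp inv]
  have iii_est': "rational_estimate \<Omega> f G (r * s) (s * (c3 / c2 powr s)) ((c2 / c1) powr s)"
    if iii: "lyapunov_iii \<Omega> f G c1 c2 c3 r s" and "c2 \<ge> 1" for c1 c2 c3 r s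
  proof (rule rational_estimate_mono_rate[OF iii_est[OF iii]])
    have c: "c3 \<ge> 0" "s > 0"
      using iii by (auto simp: lyapunov_iii_def)
    then have "c2 powr s \<ge> 1"
      using \<open>c2 \<ge> 1\<close> by (simp add: ge_one_powr_ge_zero)
    then have "c3 / c2 powr s \<le> c3 / 1"
      using c by (intro divide_left_mono) auto
    moreover have "c3 * 1 \<le> c3 * c2 powr s"
      using c \<open>c2 powr s \<ge> 1\<close> by (intro mult_left_mono) auto
    \<comment> \<open>For \<open>c2 \<ge> 1\<close> the value \<open>c3\<close> lies between the
      two, so the quotient form is a slower rate and \<open>rational_estimate_mono_rate\<close>
      applies.\<close>
    ultimately have "s * (c3 / c2 powr s) \<le> s * (c3 * c2 powr s)"
      using c by (intro mult_left_mono) auto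
    then show "s * (c3 / c2 powr s) \<le> s * c3 * c2 powr s"
      by (simp add: mult.assoc)
    show "s * (c3 / c2 powr s) \<ge> 0"
      using c by simp
  qed simp
  have iii_stable': "rationally_stable \<Omega> f G (r * s) (s * (c3 / c2 powr s)) ((c2 / c1) powr s)"
    if iii: "lyapunov_iii \<Omega> f G c1 c2 c3 r s" and "c2 \<ge> 1" "c3 > 0" "\<not> G \<subseteq> {0}" for c1 c2 c3 r s
  proof (rule rational_estimate_imp_rationally_stable)
    show "rational_estimate \<Omega> f G (r * s) (s * (c3 / c2 powr s)) ((c2 / c1) powr s)"
      by (rule iii_est'[OF that(1,2)])
    have "c2 > 0" "r > 0" "s > 0"
      using iii by (auto simp: lyapunov_iii_def)
    then show "r * s > 0" "s * (c3 / c2 powr s) > 0"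
      using \<open>c3 > 0\<close> by auto
    show "(c2 / c1) powr s \<ge> 1"
      by (rule lyapunov_iii_gain_ge_1[OF that(1,4)])
  qed
  have iv_iii: "lyapunov_iii \<Omega> f G (1 / M) 1 kbar p 1"
    if "rationally_stable \<Omega> f G p k M" "0 \<le> kbar" "kbar < k" for p k M kbar
    by (rule rationally_stable_imp_lyapunov_iii[OF wp inv that])
  have iv_ii: "lyapunov_ii \<Omega> f G (kbar / M) M p p"
    if "rationally_stable \<Omega> f G p k M" "0 \<le> kbar" "kbar < k" for p k M kbar
    by (rule lyapunov_iii_imp_ii[OF iv_iii[OF that]])
  have iv_i: "lyapunov_i \<Omega> f G (1 / M) 1 (kbar / M\<^sup>2) (2 * p) p"
    if "rationally_stable \<Omega> f G p k M" "0 \<le> kbar" "kbar < k" for p k M kbar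
    using lyapunov_ii_imp_i[OF iv_ii[OF that]] by (simp add: power2_eq_square)
  show ?thesis
    by (intro conjI allI impI; (elim conjE)?;
        (rule i_est i_stable iv_i ii_est ii_stable iv_ii iii_est
          lyapunov_iii_imp_rationally_stable[OF wp inv] iii_est' iii_stable' iv_iii; assumption))
qed

end
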